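(* For all positive integers $k$ and $\alpha$ with $\alpha < k$, there exists an unsatisfiable $\alpha$-intersecting $k$-CNF formula which simultaneously has at most $$U_i = \alpha^2\, 2^{(k+\alpha)(2+1/\alpha)}\, k^{(5+2/\alpha)}$$ clause intersection pairs, at most $$U_n = 2\alpha\, 2^{k/\alpha}\, k^{2(1+1/\alpha)}$$ variables, at most $$U_m = \alpha\, 2^{(k+\alpha)(1+1/\alpha)}\, k^{2(1+1/\alpha)}$$ clauses, and maximum clause degree at most $$U_{\Delta} = \alpha\, 2^{(k+\alpha)}\, k^2 .$$
   Context: A $k$-CNF formula is a conjunction of clauses, each clause being a disjunction of exactly $k$ literals over $k$ distinct Boolean variables; the same set of variables may underlie several clauses. The number of variables is the number of distinct variables occurring in the formula. A $k$-CNF formula is $\alpha$-intersecting if any two distinct clauses share at most $\alpha$ variables. A clause intersection pair is an unordered pair of distinct clauses that share at least one variable. The degree of a clause is the number of other clauses sharing at least one variable with it, and the maximum clause degree is the maximum of this over all clauses. *)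

theory Defs
  imports Complex_Main
begin

datatype 'v literal = Pos (var: 'v) | Neg (var: 'v)

type_synonym 'v clause = "'v literal set"

type_synonym 'v cnf = "'v clause set"

definition clause_vars :: "'v clause \<Rightarrow> 'v set" where
  "clause_vars C = var ` C"

definition cnf_vars :: "'v cnf \<Rightarrow> 'v set" where
  "cnf_vars F = (\<Union>C\<in>F. clause_vars C)"

(* The condition on clause_vars C makes the k literals have pairwise distinct variables.
   A formula is a set of clauses, so distinct clauses may still have the same variables. *)
definition k_cnf :: "nat \<Rightarrow> 'v cnf \<Rightarrow> bool" where
  "k_cnf k F \<longleftrightarrow>
     finite F \<and> (\<forall>C\<in>F. finite C \<and> card C = k \<and> card (clause_vars C) = k)"

fun literal_true :: "('v \<Rightarrow> bool) \<Rightarrow> 'v literal \<Rightarrow> bool" where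
  "literal_true \<sigma> (Pos x) \<longleftrightarrow> \<sigma> x"
| "literal_true \<sigma> (Neg x) \<longleftrightarrow> \<not> \<sigma> x"

definition satisfiable :: "'v cnf \<Rightarrow> bool" where
  "satisfiable F \<longleftrightarrow> (\<exists>\<sigma>. \<forall>C\<in>F. \<exists>l\<in>C. literal_true \<sigma> l)"

definition intersecting :: "nat \<Rightarrow> 'v cnf \<Rightarrow> bool" where
  "intersecting \<alpha> F \<longleftrightarrow>
     (\<forall>C\<in>F. \<forall>D\<in>F. C \<noteq> D \<longrightarrow> card (clause_vars C \<inter> clause_vars D) \<le> \<alpha>)"

definition intersection_pairs :: "'v cnf \<Rightarrow> 'v clause set set" where
  "intersection_pairs F =
     {{C, D} | C D. C \<in> F \<and> D \<in> F \<and> C \<noteq> D \<and> clause_vars C \<inter> clause_vars D \<noteq> {}}"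

definition clause_degree :: "'v cnf \<Rightarrow> 'v clause \<Rightarrow> nat" where
  "clause_degree F C = card {D \<in> F. D \<noteq> C \<and> clause_vars C \<inter> clause_vars D \<noteq> {}}"

(* Max is unspecified on the empty set; an unsatisfiable F is nonempty. *)
definition max_clause_degree :: "'v cnf \<Rightarrow> nat" where
  "max_clause_degree F = Max (clause_degree F ` F)"

end

theory Submission
  imports Defs "HOL-Algebra.Algebraic_Closure_Type" "HOL-Library.Z2"
begin

text \<open>Graphs of polynomials of degree at most \<open>\<alpha>\<close> over \<open>k\<close> points of the
  field with \<open>q = 2 ^ r\<close> elements give \<open>k\<close>-sets on \<open>k q\<close> vertices that pairwise share at most \<open>\<alpha>\<close>
  vertices. Restricting the non-constant part of the polynomials to \<open>2 ^ k * k\<close> choices gives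
  \<open>2 ^ k * k * q\<close> edges and vertex degree at most \<open>2 ^ k * k\<close>. Signing the edges one after the other so
  that each clause falsifies at least the fraction \<open>1 / 2 ^ k\<close> of the surviving assignments leaves
  at most \<open>2 ^ (k q) * exp (- k q) < 1\<close> of them. The smallest \<open>r\<close> with \<open>q \<ge> k\<close> and
  \<open>q ^ \<alpha> \<ge> 2 ^ k * k\<close> satisfies all the bounds.\<close>

section \<open>Finite fields of characteristic two\<close>

text \<open>Over an algebraically closed field \<open>p\<close> splits into linear factors, and a
  repeated factor would make the derivative vanish at the same point. So the multiset of roots has
  no repetitions, and its size is the degree.\<close>

lemma card_roots_separable:
  fixes p :: "'a :: alg_closed_field poly"
  assumes "p \<noteq> 0" and "\<And>x. poly p x = 0 \<Longrightarrow> poly (pderiv p) x \<noteq> 0"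
  shows "card {x. poly p x = 0} = degree p"
proof -
  obtain A where A: "size A = degree p" "p = smult (lead_coeff p) (\<Prod>x\<in>#A. [:-x, 1:])"
    using alg_closed_imp_factorization[OF assms(1)] by blast
  have roots: "poly p x = 0 \<longleftrightarrow> x \<in># A" for x
    using assms(1) by (subst A(2)) (auto simp: poly_prod_mset prod_mset_zero_iff)
  have "count A x = 1" if x: "x \<in># A" for x
  proof (rule ccontr)
    assume "count A x \<noteq> 1"
    obtain B where B: "A = add_mset x B" using x by (meson mset_add)
    with \<open>count A x \<noteq> 1\<close> have "x \<in># B" by (auto simp: not_in_iff)
    then obtain C where C: "B = add_mset x C" by (meson mset_add)
    define r where "r = smult (lead_coeff p) (\<Prod>x\<in>#C. [:-x, 1:])"
    have "p = [:-x, 1:] * ([:-x, 1:] * r)"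
      by (subst A(2)) (simp add: B C r_def)
    then have "poly (pderiv p) x = 0"
      by (simp only: pderiv_mult poly_add poly_mult) simp
    with assms(2) x roots show False by blast
  qed
  then have "size A = card (set_mset A)"
    by (simp add: size_multiset_overloaded_eq)
  with A(1) roots show ?thesis by simp
qed

lemma alg_closure_bit_two [simp]: "(2 :: bit alg_closure) = 0"
proof -
  have "(2 :: bit) = 0" by simp
  then show ?thesis by (metis to_ac_0 to_ac_numeral)
qed

text \<open>Iterated Frobenius map: in characteristic two the cross term of
  \<open>(x + y) ^ 2\<close> vanishes.\<close>

lemma add_power_two_power:
  fixes x y :: "bit alg_closure"
  shows "(x + y) ^ (2 ^ r) = x ^ (2 ^ r) + y ^ (2 ^ r)"
proof (induction r)
  case (Suc r)
  then show ?case by (simp add: power_mult power2_sum mult.commute[of 2])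
qed simp

text \<open>\<open>K\<close> consists of the fixed points of the \<open>r\<close>-fold Frobenius
  map, that is, the roots of X^q - X with \<open>q = 2 ^ r\<close>. The closure properties hold
  because that map is additive and multiplicative.\<close>

lemma finite_subfield_alg_closure_bit:
  assumes "0 < r"
  obtains K :: "bit alg_closure set"
  where "card K = 2 ^ r" and "0 \<in> K"
    and "\<And>x y. x \<in> K \<Longrightarrow> y \<in> K \<Longrightarrow> x + y \<in> K"
    and "\<And>x y. x \<in> K \<Longrightarrow> y \<in> K \<Longrightarrow> x * y \<in> K"
proof
  define q :: nat where "q = 2 ^ r"
  have q: "1 < q" using assms unfolding q_def by (intro one_less_power) simp_all
  define p :: "bit alg_closure poly" where "p = monom 1 q - monom 1 1"
  let ?K = "{x. poly p x = 0}"
  have K: "x \<in> ?K \<longleftrightarrow> x ^ q = x" for x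
    by (simp add: p_def poly_monom)
  have deg: "degree p = q"
    unfolding p_def diff_conv_add_uminus
    by (subst degree_add_eq_left) (use q in \<open>simp_all add: degree_monom_eq\<close>)
  \<comment> \<open>As \<open>0 < r\<close>, \<open>q\<close> is even and vanishes in the field, so
    the derivative of \<open>p\<close> is the constant -1 and all roots are simple.\<close>
  have "of_nat q = (0 :: bit alg_closure)"
    using assms by (simp add: q_def)
  then have "pderiv p = [:-1:]"
    by (simp add: p_def pderiv_diff pderiv_monom monom_0)
  then have "card ?K = degree p"
    using deg q by (intro card_roots_separable) auto
  then show "card ?K = 2 ^ r" by (simp add: deg q_def)
  show "0 \<in> ?K" using q unfolding K by simp
  show "x + y \<in> ?K" if "x \<in> ?K" "y \<in> ?K" for x y
    using that unfolding K q_def by (simp add: add_power_two_power)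
  show "x * y \<in> ?K" if "x \<in> ?K" "y \<in> ?K" for x y
    using that unfolding K by (simp add: power_mult_distrib)
qed

section \<open>Hypergraphs from graphs of polynomials\<close>

lemma poly_Poly_in:
  assumes "0 \<in> K" and "\<And>x y. x \<in> K \<Longrightarrow> y \<in> K \<Longrightarrow> x + y \<in> K"
    and "\<And>x y. x \<in> K \<Longrightarrow> y \<in> K \<Longrightarrow> x * y \<in> K"
    and "set xs \<subseteq> K" and "x \<in> K"
  shows "poly (Poly xs) x \<in> K"
  using assms(4) by (induction xs) (simp_all add: assms(1-3,5))

text \<open>\<open>Poly\<close> drops trailing zeros, but at a fixed length the coefficients still
  determine the list. This lets polynomials be counted through lists.\<close>

lemma inj_on_Poly: "inj_on Poly {xs. length xs = n}"
proof (rule inj_onI)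
  fix xs ys :: "'a list"
  assume *: "xs \<in> {xs. length xs = n}" "ys \<in> {xs. length xs = n}" "Poly xs = Poly ys"
  show "xs = ys"
  proof (rule nth_equalityI)
    fix i assume "i < length xs"
    have "nth_default 0 xs i = nth_default 0 ys i" using *(3) by (metis coeff_Poly_eq)
    with * \<open>i < length xs\<close> show "xs ! i = ys ! i" by (simp add: nth_default_def)
  qed (use * in simp)
qed

text \<open>The edges are the graphs of \<open>x \<mapsto> c + x p(x)\<close> over \<open>k\<close> points of a finite field. Letting
  the constant term \<open>c\<close> range over the whole field makes every vertex degree at most \<open>t\<close>.\<close>

lemma ex_regular_uniform_hypergraph:
  fixes k \<alpha> r t :: nat
  assumes "0 < r" and "0 < \<alpha>" and "\<alpha> < k" and "k \<le> 2 ^ r" and "t \<le> (2 ^ r) ^ \<alpha>"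
  obtains E :: "nat set set"
  where "finite E" and "card E = 2 ^ r * t" and "\<And>e. e \<in> E \<Longrightarrow> finite e \<and> card e = k"
    and "\<And>e e'. e \<in> E \<Longrightarrow> e' \<in> E \<Longrightarrow> e \<noteq> e' \<Longrightarrow> card (e \<inter> e') \<le> \<alpha>"
    and "card (\<Union>E) \<le> k * 2 ^ r" and "\<And>v. card {e \<in> E. v \<in> e} \<le> t"
proof -
  obtain K :: "bit alg_closure set" where K: "card K = 2 ^ r" "0 \<in> K"
    and add: "\<And>x y. x \<in> K \<Longrightarrow> y \<in> K \<Longrightarrow> x + y \<in> K"
    and mult: "\<And>x y. x \<in> K \<Longrightarrow> y \<in> K \<Longrightarrow> x * y \<in> K"
    using finite_subfield_alg_closure_bit[OF assms(1)] by metis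
  have finK: "finite K" using K(1) by (intro card_ge_0_finite) simp
  obtain S where S: "S \<subseteq> K" "card S = k" "finite S"
    using obtain_subset_with_card_n[of k K] K(1) assms(4) by metis
  \<comment> \<open>Lists of length \<open>\<alpha>\<close> give polynomials of degree below
    \<open>\<alpha>\<close>, so \<open>pCons c p\<close> has degree at most
    \<open>\<alpha>\<close>.\<close>
  let ?P = "Poly ` {xs. set xs \<subseteq> K \<and> length xs = \<alpha>}"
  have "card ?P = card {xs. set xs \<subseteq> K \<and> length xs = \<alpha>}"
    by (intro card_image inj_on_subset[OF inj_on_Poly[of \<alpha>]]) auto
  then have t: "t \<le> card ?P"
    using assms(5) by (simp add: card_lists_length_eq finK K(1))
  obtain Q where Q: "Q \<subseteq> ?P" "card Q = t" "finite Q"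
    by (rule obtain_subset_with_card_n[OF t])
  have deg: "degree (pCons c p) \<le> \<alpha>" if p: "p \<in> Q" for c p
  proof -
    obtain xs where "p = Poly xs" "length xs = \<alpha>" using Q(1) p by blast
    then show ?thesis
      by (intro degree_le allI impI) (auto simp: coeff_pCons nth_default_beyond split: nat.split)
  qed
  have Q_in: "poly p x \<in> K" if p: "p \<in> Q" and x: "x \<in> S" for p x
  proof -
    obtain xs where "p = Poly xs" "set xs \<subseteq> K" using Q(1) p by blast
    moreover have "x \<in> K" using S(1) x by blast
    ultimately show ?thesis using poly_Poly_in[of K xs x] K(2) add mult by blast
  qed
  \<comment> \<open>\<open>\<phi>\<close> codes the points of \<open>S \<times> K\<close> as natural
    numbers, the vertex type of \<open>E\<close>.\<close>
  obtain \<phi> :: "bit alg_closure \<times> bit alg_closure \<Rightarrow> nat" where phi: "inj_on \<phi> (S \<times> K)"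
    using finite_imp_inj_to_nat_seg[of "S \<times> K"] S(3) finK by auto
  define edge where "edge = (\<lambda>(c, p). (\<lambda>x. \<phi> (x, poly (pCons c p) x)) ` S)"
  have val: "poly (pCons c p) x \<in> K" if "c \<in> K" "p \<in> Q" "x \<in> S" for c p x
    unfolding poly_pCons using that Q_in S(1) by (blast intro: add mult)
  have phi_eq: "x = x' \<and> y = y'"
    if "\<phi> (x, y) = \<phi> (x', y')" "x \<in> S" "x' \<in> S" "y \<in> K" "y' \<in> K" for x y x' y'
    using inj_onD[OF phi that(1)] that by auto
  have card_edge: "card (edge (c, p)) = k" if "c \<in> K" "p \<in> Q" for c p
    unfolding edge_def prod.case S(2)[symmetric]
    by (intro card_image inj_onI) (use phi_eq val that in blast)
  have int_edge: "card (edge (c, p) \<inter> edge (c', p')) \<le> \<alpha>"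
    if *: "c \<in> K" "p \<in> Q" "c' \<in> K" "p' \<in> Q" "(c, p) \<noteq> (c', p')" for c p c' p'
  proof -
    let ?d = "pCons c p - pCons c' p'"
    have "?d \<noteq> 0" using *(5) by auto
    have fin: "finite {x. poly ?d x = 0}" using \<open>?d \<noteq> 0\<close> by (rule poly_roots_finite)
    \<comment> \<open>A vertex determines its point, so a common vertex lies over a root of
      \<open>?d\<close>, a nonzero polynomial of degree at most \<open>\<alpha>\<close>.\<close>
    have "edge (c, p) \<inter> edge (c', p') \<subseteq> (\<lambda>x. \<phi> (x, poly (pCons c p) x)) ` {x. poly ?d x = 0}"
    proof
      fix v assume "v \<in> edge (c, p) \<inter> edge (c', p')"
      then obtain x x' where x: "v = \<phi> (x, poly (pCons c p) x)" "x \<in> S"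
        "v = \<phi> (x', poly (pCons c' p') x')" "x' \<in> S"
        unfolding edge_def prod.case by blast
      then have "x = x' \<and> poly (pCons c p) x = poly (pCons c' p') x'"
        using * by (intro phi_eq val) simp_all
      then have "poly ?d x = 0" unfolding poly_diff right_minus_eq by metis
      with x(1) show "v \<in> (\<lambda>x. \<phi> (x, poly (pCons c p) x)) ` {x. poly ?d x = 0}" by blast
    qed
    then have "card (edge (c, p) \<inter> edge (c', p')) \<le> card {x. poly ?d x = 0}"
      using fin by (rule surj_card_le[rotated])
    also have "\<dots> \<le> degree ?d" using \<open>?d \<noteq> 0\<close> by (rule card_poly_roots_bound)
    also have "\<dots> \<le> \<alpha>" using deg * by (intro degree_diff_le) auto
    finally show ?thesis .
  qed
  \<comment> \<open>Equal edges with different parameters would share \<open>k > \<alpha>\<close>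
    vertices.\<close>
  have inj: "inj_on edge (K \<times> Q)"
  proof (rule inj_onI, rule ccontr)
    fix a b assume *: "a \<in> K \<times> Q" "b \<in> K \<times> Q" "edge a = edge b" "a \<noteq> b"
    obtain c p c' p' where ab: "a = (c, p)" "b = (c', p')" by (cases a, cases b)
    have "card (edge a \<inter> edge b) \<le> \<alpha>" using int_edge *(1,2,4) unfolding ab by blast
    moreover have "card (edge a) = k" using card_edge *(1) unfolding ab by blast
    ultimately show False using *(3) assms(3) by simp
  qed
  let ?E = "edge ` (K \<times> Q)"
  show thesis
  proof
    show "finite ?E" using finK Q(3) by simp
    show "card ?E = 2 ^ r * t"
      using card_image[OF inj] by (simp add: card_cartesian_product K(1) Q(2))
    show "finite e \<and> card e = k" if "e \<in> ?E" for e
      using that card_edge S(3) by (auto simp: edge_def)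
    show "card (e \<inter> e') \<le> \<alpha>" if "e \<in> ?E" "e' \<in> ?E" "e \<noteq> e'" for e e'
      using that int_edge by fastforce
    have "\<Union>?E \<subseteq> \<phi> ` (S \<times> K)"
      using val by (force simp: edge_def)
    then have "card (\<Union>?E) \<le> card (S \<times> K)"
      using S(3) finK by (intro surj_card_le) auto
    then show "card (\<Union>?E) \<le> k * 2 ^ r" by (simp add: card_cartesian_product S(2) K(1))
    show "card {e \<in> ?E. v \<in> e} \<le> t" for v
    proof (cases "v \<in> \<phi> ` (S \<times> K)")
      case True
      then obtain x y where v: "v = \<phi> (x, y)" "x \<in> S" "y \<in> K" by auto
      \<comment> \<open>Through the vertex coded by \<open>(x, y)\<close> each \<open>p\<close>
        admits only the constant term \<open>y - x * poly p x\<close>, so at most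
        \<open>card Q = t\<close> edges pass.\<close>
      have "{e \<in> ?E. v \<in> e} \<subseteq> (\<lambda>p. edge (y - x * poly p x, p)) ` Q"
      proof
        fix e assume "e \<in> {e \<in> ?E. v \<in> e}"
        then obtain c p where cp: "c \<in> K" "p \<in> Q" "e = edge (c, p)" "v \<in> e" by auto
        then obtain x' where x': "x' \<in> S" "v = \<phi> (x', poly (pCons c p) x')"
          unfolding edge_def by auto
        have "x = x' \<and> y = poly (pCons c p) x'"
          using v x' cp by (intro phi_eq val) simp_all
        then have "c = y - x * poly p x" by simp
        with cp show "e \<in> (\<lambda>p. edge (y - x * poly p x, p)) ` Q" by blast
      qed
      then show ?thesis unfolding Q(2)[symmetric] using Q(3) by (intro surj_card_le)
    next
      case False
      then have "{e \<in> ?E. v \<in> e} = {}" using \<open>\<Union>?E \<subseteq> \<phi> ` (S \<times> K)\<close> by blast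
      then show ?thesis by (simp only: card.empty)
    qed
  qed
qed

section \<open>Signing the edges\<close>

text \<open>The unique clause with variable set \<open>e\<close> that is falsified by exactly those assignments whose
  set of true variables meets \<open>e\<close> in \<open>A\<close>.\<close>

definition forbid :: "'v set \<Rightarrow> 'v set \<Rightarrow> 'v clause" where
  "forbid A e = (\<lambda>x. if x \<in> A then Neg x else Pos x) ` e"

lemma clause_vars_forbid [simp]: "clause_vars (forbid A e) = e"
  unfolding clause_vars_def forbid_def image_image by (auto simp add: if_distrib[of var])

lemma card_forbid [simp]: "card (forbid A e) = card e"
  unfolding forbid_def by (intro card_image inj_onI) (auto split: if_splits)

lemma forbid_true_iff:
  assumes "A \<subseteq> e"
  shows "(\<exists>l\<in>forbid A e. literal_true \<sigma> l) \<longleftrightarrow> {x. \<sigma> x} \<inter> e \<noteq> A"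
proof -
  have "(\<exists>l\<in>forbid A e. literal_true \<sigma> l) \<longleftrightarrow> (\<exists>x\<in>e. (x \<in> A) \<noteq> \<sigma> x)"
    unfolding forbid_def bex_simps(7) by (intro bex_cong refl) simp
  also have "\<dots> \<longleftrightarrow> {x. \<sigma> x} \<inter> e \<noteq> A" using assms by blast
  finally show ?thesis .
qed

text \<open>By averaging over the \<open>2 ^ k\<close> patterns on one edge, some pattern excludes at least the
  fraction \<open>1 / 2 ^ k\<close> of the assignments surviving so far.\<close>

lemma ex_patterns_few_survivors:
  assumes "finite E" and "\<And>e. e \<in> E \<Longrightarrow> finite e \<and> card e = k" and "finite W"
  shows "\<exists>f. (\<forall>e\<in>E. f e \<subseteq> e) \<and>
    real (card {T \<in> W. \<forall>e\<in>E. T \<inter> e \<noteq> f e}) \<le> real (card W) * (1 - 1 / 2 ^ k) ^ card E"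
  using assms(1,2)
proof (induction E)
  case (insert a E)
  then obtain f where f: "\<forall>e\<in>E. f e \<subseteq> e"
    "real (card {T \<in> W. \<forall>e\<in>E. T \<inter> e \<noteq> f e}) \<le> real (card W) * (1 - 1 / 2 ^ k) ^ card E"
    by auto
  define S where "S = {T \<in> W. \<forall>e\<in>E. T \<inter> e \<noteq> f e}"
  have a: "finite a" "card a = k" using insert.prems by auto
  have finS: "finite S" using assms(3) by (simp add: S_def)
  have "\<exists>A\<in>Pow a. real (card S) / 2 ^ k \<le> real (card {T \<in> S. T \<inter> a = A})"
  proof (rule ccontr)
    assume "\<not> ?thesis"
    then have "(\<Sum>A\<in>Pow a. real (card {T \<in> S. T \<inter> a = A})) < (\<Sum>A\<in>Pow a. real (card S) / 2 ^ k)"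
      using a by (intro sum_strict_mono) (auto simp: not_le)
    also have "\<dots> = real (card S)" using a by (simp add: card_Pow)
    \<comment> \<open>Every \<open>T\<close> in \<open>S\<close> lies in exactly one class, given by
      its trace on \<open>a\<close>.\<close>
    also have "card S = (\<Sum>A\<in>Pow a. card {T \<in> S. T \<inter> a = A})"
      using sum.group[of S "Pow a" "\<lambda>T. T \<inter> a" "\<lambda>_. 1 :: nat"] a finS
      by (simp add: image_subset_iff)
    finally show False by simp
  qed
  then obtain A where A: "A \<subseteq> a" "real (card S) / 2 ^ k \<le> real (card {T \<in> S. T \<inter> a = A})"
    by auto
  define g where "g = f(a := A)"
  have g: "g e = f e" if "e \<in> E" for e using that insert.hyps by (auto simp: g_def)
  \<comment> \<open>Assigning the pattern \<open>A\<close> to \<open>a\<close> removes exactly the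
    class of \<open>A\<close>, which supplies the new factor \<open>1 - 1 / 2 ^ k\<close>.\<close>
  have "{T \<in> W. \<forall>e\<in>insert a E. T \<inter> e \<noteq> g e} = S - {T \<in> S. T \<inter> a = A}"
    using g by (auto simp: S_def g_def)
  then have "real (card {T \<in> W. \<forall>e\<in>insert a E. T \<inter> e \<noteq> g e})
      = real (card S) - real (card {T \<in> S. T \<inter> a = A})"
    using finS by (simp add: card_Diff_subset card_mono of_nat_diff)
  also have "\<dots> \<le> real (card S) * (1 - 1 / 2 ^ k)"
    using A(2) by (simp add: algebra_simps)
  also have "\<dots> \<le> real (card W) * (1 - 1 / 2 ^ k) ^ card E * (1 - 1 / 2 ^ k)"
    using f(2) by (intro mult_right_mono) (simp_all add: S_def)
  also have "\<dots> = real (card W) * (1 - 1 / 2 ^ k) ^ card (insert a E)"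
    using insert.hyps by simp
  finally have "real (card {T \<in> W. \<forall>e\<in>insert a E. T \<inter> e \<noteq> g e})
      \<le> real (card W) * (1 - 1 / 2 ^ k) ^ card (insert a E)" .
  moreover have "\<forall>e\<in>insert a E. g e \<subseteq> e" using f(1) A(1) by (simp add: g g_def)
  ultimately show ?case by blast
qed simp

text \<open>Only the set of true variables inside \<open>\<Union>E\<close> matters, so there are
  \<open>2 ^ card (\<Union>E)\<close> candidates. The number of survivors is a natural number below
  1, hence zero.\<close>

lemma ex_unsatisfiable_signing:
  assumes "finite E" and "\<And>e. e \<in> E \<Longrightarrow> finite e \<and> card e = k"
    and "2 ^ card (\<Union>E) * (1 - 1 / 2 ^ k) ^ card E < (1 :: real)"
  obtains f where "\<not> satisfiable ((\<lambda>e. forbid (f e) e) ` E)"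
proof -
  have fin: "finite (\<Union>E)" using assms by blast
  then obtain f where f: "\<forall>e\<in>E. f e \<subseteq> e"
    "real (card {T \<in> Pow (\<Union>E). \<forall>e\<in>E. T \<inter> e \<noteq> f e}) \<le> 2 ^ card (\<Union>E) * (1 - 1 / 2 ^ k) ^ card E"
    using ex_patterns_few_survivors[OF assms(1,2), where W = "Pow (\<Union>E)"] by (auto simp: card_Pow)
  then have "card {T \<in> Pow (\<Union>E). \<forall>e\<in>E. T \<inter> e \<noteq> f e} = 0"
    using assms(3) by linarith
  then have none: "{T \<in> Pow (\<Union>E). \<forall>e\<in>E. T \<inter> e \<noteq> f e} = {}"
    using fin by simp
  have "\<not> satisfiable ((\<lambda>e. forbid (f e) e) ` E)"
  proof
    assume "satisfiable ((\<lambda>e. forbid (f e) e) ` E)"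
    then obtain \<sigma> where \<sigma>: "\<forall>e\<in>E. {x. \<sigma> x} \<inter> e \<noteq> f e"
      using f(1) by (auto simp: satisfiable_def forbid_true_iff)
    \<comment> \<open>Cutting a satisfying assignment down to \<open>\<Union>E\<close> leaves its
      trace on every edge unchanged, so it would be a survivor.\<close>
    have "{x. \<sigma> x} \<inter> \<Union>E \<inter> e = {x. \<sigma> x} \<inter> e" if "e \<in> E" for e using that by blast
    with \<sigma> have "{x. \<sigma> x} \<inter> \<Union>E \<in> {T \<in> Pow (\<Union>E). \<forall>e\<in>E. T \<inter> e \<noteq> f e}" by auto
    with none show False by blast
  qed
  with that show thesis .
qed

section \<open>Degrees and intersection pairs\<close>

text \<open>Every unordered pair is the image of an ordered pair of a clause and a neighbour, and
  the degree sum counts the ordered pairs.\<close>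

lemma card_intersection_pairs_le:
  assumes "finite F" and "\<And>C. C \<in> F \<Longrightarrow> clause_degree F C \<le> d"
  shows "card (intersection_pairs F) \<le> card F * d"
proof -
  let ?N = "\<lambda>C. {D \<in> F. D \<noteq> C \<and> clause_vars C \<inter> clause_vars D \<noteq> {}}"
  have "intersection_pairs F \<subseteq> (\<lambda>(C, D). {C, D}) ` Sigma F ?N"
    unfolding intersection_pairs_def by fastforce
  then have "card (intersection_pairs F) \<le> card (Sigma F ?N)"
    using assms(1) by (intro surj_card_le) auto
  also have "\<dots> = (\<Sum>C\<in>F. clause_degree F C)"
    using assms(1) by (simp add: clause_degree_def)
  also have "\<dots> \<le> card F * d"
    using sum_bounded_above[of F "clause_degree F" d] assms(2) by simp
  finally show ?thesis .
qed

text \<open>Union bound: each neighbour of \<open>C\<close> contains a variable of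
  \<open>C\<close>.\<close>

lemma clause_degree_le:
  assumes "finite F" and "finite (clause_vars C)"
    and "\<And>v. card {D \<in> F. v \<in> clause_vars D} \<le> t"
  shows "clause_degree F C \<le> card (clause_vars C) * t"
proof -
  have "clause_degree F C \<le> card (\<Union>v\<in>clause_vars C. {D \<in> F. v \<in> clause_vars D})"
    unfolding clause_degree_def using assms by (intro card_mono) auto
  also have "\<dots> \<le> (\<Sum>v\<in>clause_vars C. card {D \<in> F. v \<in> clause_vars D})"
    using assms(2) by (rule card_UN_le)
  also have "\<dots> \<le> card (clause_vars C) * t"
    using sum_bounded_above[of "clause_vars C" "\<lambda>v. card {D \<in> F. v \<in> clause_vars D}" t] assms(3)
    by simp
  finally show ?thesis .
qed

section \<open>Field size and numerical estimates\<close>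

text \<open>The lower bounds provide \<open>k\<close> evaluation points and \<open>2 ^ k * k\<close>
  polynomials. For the least suitable \<open>r\<close> the predecessor violates one of them, which
  bounds \<open>2 ^ r\<close> from above up to a factor 2.\<close>

lemma ex_power_of_two_between:
  fixes k \<alpha> :: nat
  assumes "0 < \<alpha>" and "\<alpha> < k"
  obtains r where "0 < r" and "k \<le> 2 ^ r" and "2 ^ k * k \<le> (2 ^ r) ^ \<alpha>"
    and "2 ^ r \<le> 2 * real \<alpha> * 2 powr (real k / real \<alpha>) * real k powr (1 + 2 / real \<alpha>)"
proof -
  define P where "P r \<longleftrightarrow> k \<le> 2 ^ r \<and> 2 ^ k * k \<le> (2 ^ r) ^ \<alpha>" for r :: nat
  have k: "2 \<le> k" using assms by simp
  have pow: "n \<le> 2 ^ n" for n :: nat using less_exp[of n] by simp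
  \<comment> \<open>A crude witness that some exponent satisfies \<open>P\<close>, as
    \<open>LEAST\<close> requires.\<close>
  have "P (2 ^ k * k)"
  proof -
    have "k \<le> 2 ^ k * k" by simp
    also have *: "2 ^ k * k \<le> 2 ^ (2 ^ k * k)" by (rule pow)
    finally have "k \<le> 2 ^ (2 ^ k * k)" .
    moreover have "(2 ^ (2 ^ k * k)) ^ 1 \<le> ((2 :: nat) ^ (2 ^ k * k)) ^ \<alpha>"
      using assms by (intro power_increasing) auto
    ultimately show ?thesis using * unfolding P_def power_one_right by linarith
  qed
  define r where "r = (LEAST r. P r)"
  have r: "P r" unfolding r_def by (rule LeastI[of P]) fact
  \<comment> \<open>\<open>P 0\<close> would force \<open>k \<le> 1\<close>; hence \<open>r\<close>
    has a predecessor \<open>s\<close>, and minimality refutes \<open>P s\<close>.\<close>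
  have "r \<noteq> 0" using r k by (cases "r = 0") (auto simp: P_def)
  then obtain s where s: "r = Suc s" using not0_implies_Suc by blast
  have "\<not> P s" using not_less_Least[of s P] s r_def by simp
  have le1: "1 \<le> 2 powr (real k / real \<alpha>)" by (simp add: ge_one_powr_ge_zero)
  have le3: "real k powr (1 / real \<alpha>) \<le> real k powr (1 + 2 / real \<alpha>)"
    using k divide_right_mono[of 1 2 "real \<alpha>"] by (intro powr_mono) simp_all
  have le4: "real k \<le> real k powr (1 + 2 / real \<alpha>)"
    using powr_mono[of 1 "1 + 2 / real \<alpha>" "real k"] k by simp
  have "2 ^ s \<le> 2 powr (real k / real \<alpha>) * real k powr (1 + 2 / real \<alpha>)"
  proof (cases "2 ^ s < k")
    case True
    then have "(2 :: real) ^ s \<le> 1 * real k" by simp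
    also have "\<dots> \<le> 2 powr (real k / real \<alpha>) * real k powr (1 + 2 / real \<alpha>)"
      using le1 le4 by (intro mult_mono) auto
    finally show ?thesis .
  next
    case False
    with \<open>\<not> P s\<close> have "(2 ^ s) ^ \<alpha> < 2 ^ k * k" by (simp add: P_def)
    then have "real ((2 ^ s) ^ \<alpha>) \<le> real (2 ^ k * k)" by linarith
    then have "((2 :: real) ^ s) ^ \<alpha> \<le> 2 ^ k * real k" by simp
    then have "(((2 :: real) ^ s) ^ \<alpha>) powr (1 / real \<alpha>) \<le> (2 ^ k * real k) powr (1 / real \<alpha>)"
      by (intro powr_mono2) auto
    also have "(((2 :: real) ^ s) ^ \<alpha>) powr (1 / real \<alpha>) = 2 ^ s"
      using assms by (simp add: powr_realpow[symmetric] powr_powr)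
    also have "(2 ^ k * real k) powr (1 / real \<alpha>) = 2 powr (real k / real \<alpha>) * real k powr (1 / real \<alpha>)"
      by (simp add: powr_mult powr_realpow[symmetric] powr_powr)
    also have "\<dots> \<le> 2 powr (real k / real \<alpha>) * real k powr (1 + 2 / real \<alpha>)"
      using le3 by (intro mult_left_mono) auto
    finally show ?thesis .
  qed
  \<comment> \<open>Passing from \<open>s\<close> to \<open>Suc s\<close> costs the factor 2; the
    factor \<open>\<alpha>\<close> is at least 1.\<close>
  then have "2 ^ r \<le> 2 * 1 * (2 powr (real k / real \<alpha>) * real k powr (1 + 2 / real \<alpha>))"
    by (simp add: s)
  also have "\<dots> \<le> 2 * real \<alpha> * (2 powr (real k / real \<alpha>) * real k powr (1 + 2 / real \<alpha>))"
    using assms by (intro mult_right_mono mult_left_mono) auto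
  finally show thesis using that[of r] r \<open>r \<noteq> 0\<close> by (simp add: P_def mult.assoc)
qed

text \<open>Since 1 - x is at most exp(-x), \<open>(1 - 1 / real N) ^ N\<close> is at most 1/e,
  which is below 1/2. Doubling it and taking the \<open>n\<close>-th power stays below 1.\<close>

lemma two_power_mult_less_one:
  fixes N n :: nat
  assumes "0 < N" and "0 < n"
  shows "2 ^ n * (1 - 1 / real N) ^ (N * n) < 1"
proof -
  have "1 - 1 / real N \<le> exp (- (1 / real N))" using exp_ge_add_one_self[of "- (1 / real N)"] by simp
  then have "(1 - 1 / real N) ^ N \<le> exp (- (1 / real N)) ^ N" using assms by (intro power_mono) auto
  also have "\<dots> = exp (- 1)" using assms by (simp flip: exp_of_nat_mult)
  finally have "2 * (1 - 1 / real N) ^ N \<le> 2 * exp (- 1)" by simp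
  \<comment> \<open>The cited bound gives (1 + 1/2)^2 = 9/4 as a lower bound for e, so 2/e is at
    most 8/9.\<close>
  also have "\<dots> < 1" using exp_ge_one_plus_x_over_n_power_n[of 2 1] 
    by (simp add: exp_minus field_simps power2_eq_square)
  finally have "(2 * (1 - 1 / real N) ^ N) ^ n < 1" using assms by (intro power_less_one_iff[THEN iffD2]) auto
  then show ?thesis by (simp add: power_mult_distrib power_mult)
qed

section \<open>Assembling the formula\<close>

theorem theorem3:
  fixes k \<alpha> :: nat
  assumes "0 < k" and "0 < \<alpha>" and "\<alpha> < k"
  shows "\<exists>F :: nat cnf.
    k_cnf k F \<and> intersecting \<alpha> F \<and> \<not> satisfiable F \<and>
    real (card (intersection_pairs F))
      \<le> (real \<alpha>)\<^sup>2 * 2 powr ((real k + real \<alpha>) * (2 + 1 / real \<alpha>)) * real k powr (5 + 2 / real \<alpha>) \<and>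
    real (card (cnf_vars F))
      \<le> 2 * real \<alpha> * 2 powr (real k / real \<alpha>) * real k powr (2 * (1 + 1 / real \<alpha>)) \<and>
    real (card F)
      \<le> real \<alpha> * 2 powr ((real k + real \<alpha>) * (1 + 1 / real \<alpha>)) * real k powr (2 * (1 + 1 / real \<alpha>)) \<and>
    real (max_clause_degree F)
      \<le> real \<alpha> * 2 ^ (k + \<alpha>) * (real k)\<^sup>2"
proof -
  obtain r where r: "0 < r" "k \<le> 2 ^ r" "2 ^ k * k \<le> (2 ^ r) ^ \<alpha>"
    and r_le: "2 ^ r \<le> 2 * real \<alpha> * 2 powr (real k / real \<alpha>) * real k powr (1 + 2 / real \<alpha>)"
    using ex_power_of_two_between[OF assms(2,3)] .
  \<comment> \<open>With \<open>t = 2 ^ k * k\<close> the number of edges is \<open>2 ^ k\<close>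
    times the bound \<open>k * 2 ^ r\<close> on the vertices, the ratio used in
    \<open>two_power_mult_less_one\<close>.\<close>
  obtain E :: "nat set set" where finE: "finite E" and cardE: "card E = 2 ^ r * (2 ^ k * k)"
    and E: "\<And>e. e \<in> E \<Longrightarrow> finite e \<and> card e = k"
    and int: "\<And>e e'. e \<in> E \<Longrightarrow> e' \<in> E \<Longrightarrow> e \<noteq> e' \<Longrightarrow> card (e \<inter> e') \<le> \<alpha>"
    and vars: "card (\<Union>E) \<le> k * 2 ^ r" and deg: "\<And>v. card {e \<in> E. v \<in> e} \<le> 2 ^ k * k"
    by (rule ex_regular_uniform_hypergraph[OF r(1) assms(2,3) r(2,3)]) blast
  have "2 ^ card (\<Union>E) * (1 - 1 / 2 ^ k) ^ card E
      \<le> 2 ^ (k * 2 ^ r) * (1 - 1 / 2 ^ k :: real) ^ card E"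
    using vars by (intro mult_right_mono power_increasing) simp_all
  also have "\<dots> = 2 ^ (k * 2 ^ r) * (1 - 1 / real (2 ^ k)) ^ (2 ^ k * (k * 2 ^ r))"
    by (simp add: cardE mult_ac)
  also have "\<dots> < 1" using assms(1) by (intro two_power_mult_less_one) simp_all
  finally have few: "2 ^ card (\<Union>E) * (1 - 1 / 2 ^ k) ^ card E < (1 :: real)" .
  obtain f where f: "\<not> satisfiable ((\<lambda>e. forbid (f e) e) ` E)"
    by (rule ex_unsatisfiable_signing[OF finE E few])
  have k: "1 \<le> real k" and a: "1 \<le> real \<alpha>" using assms by simp_all
  \<comment> \<open>Opens the exponents of 2 in the target bounds: \<open>c = 1\<close> for clauses,
    \<open>c = 2\<close> for intersection pairs.\<close>
  have expand: "(real k + real \<alpha>) * (c + 1 / real \<alpha>)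
      = c * real k + c * real \<alpha> + real k / real \<alpha> + 1" for c
    using a by (simp add: distrib_left distrib_right mult.commute)
  define F where "F = (\<lambda>e. forbid (f e) e) ` E"
  have finF: "finite F" using finE by (simp add: F_def)
  \<comment> \<open>An edge is the variable set of its clause, so signing merges no two
    edges.\<close>
  have "inj_on (\<lambda>e. forbid (f e) e) E" 
    using clause_vars_forbid by (intro inj_on_inverseI[where g = clause_vars])
  then have cardF: "card F = 2 ^ r * (2 ^ k * k)" by (simp add: F_def card_image cardE)
  \<comment> \<open>Nonemptiness makes \<open>Max\<close> meaningful in
    \<open>max_clause_degree\<close>.\<close>
  have "F \<noteq> {}" using cardF assms(1) by auto
  have F: "finite C \<and> card C = k \<and> finite (clause_vars C) \<and> card (clause_vars C) = k" if "C \<in> F" for C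
    using that E by (auto simp: F_def) (simp add: forbid_def)
  have occ: "card {D \<in> F. v \<in> clause_vars D} \<le> 2 ^ k * k" for v
  proof -
    have "{D \<in> F. v \<in> clause_vars D} = (\<lambda>e. forbid (f e) e) ` {e \<in> E. v \<in> e}"
      by (auto simp: F_def)
    then have "card {D \<in> F. v \<in> clause_vars D} \<le> card {e \<in> E. v \<in> e}"
      using finE by (simp add: card_image_le)
    with deg[of v] show ?thesis by simp
  qed
  have degF: "clause_degree F C \<le> k * (2 ^ k * k)" if "C \<in> F" for C
    using clause_degree_le[OF finF _ occ, of C] F[OF that] by simp
  have "k_cnf k F" using finF F by (simp add: k_cnf_def)
  moreover have "intersecting \<alpha> F"
    unfolding intersecting_def F_def using int by auto
  moreover have "real (card (intersection_pairs F))
      \<le> (real \<alpha>)\<^sup>2 * 2 powr ((real k + real \<alpha>) * (2 + 1 / real \<alpha>)) * real k powr (5 + 2 / real \<alpha>)"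
  proof -
    have "real (card (intersection_pairs F)) \<le> real (2 ^ r * (2 ^ k * k) * (k * (2 ^ k * k)))"
      using card_intersection_pairs_le[OF finF degF] cardF
      by (intro of_nat_mono) simp
    also have "\<dots> = 2 ^ (2 * k) * real k ^ 3 * 2 ^ r"
      by (simp add: mult_2 power_add power3_eq_cube)
    also have "\<dots> \<le> 2 ^ (2 * k) * real k ^ 3 *
        (2 * real \<alpha> * 2 powr (real k / real \<alpha>) * real k powr (1 + 2 / real \<alpha>))"
      using r_le by (intro mult_left_mono) simp_all
    \<comment> \<open>The factor 2 becomes the summand 1 in the exponent, and
      \<open>real k ^ 3\<close> is absorbed into the power of \<open>k\<close>.\<close>
    also have "\<dots> = real \<alpha> * 2 powr (2 * real k + 1 + real k / real \<alpha>) * real k powr (4 + 2 / real \<alpha>)"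
      using powr_realpow[of 2 "2 * k"] powr_add[of "real k" 3 "1 + 2 / real \<alpha>"] k
      by (simp add: powr_add[of 2] mult_ac)
    \<comment> \<open>The target is larger by the factors \<open>\<alpha>\<close>,
      \<open>2 powr (2 * \<alpha>)\<close> and \<open>k\<close>, all at least 1.\<close>
    also have "\<dots> \<le> (real \<alpha>)\<^sup>2 * 2 powr ((real k + real \<alpha>) * (2 + 1 / real \<alpha>)) * real k powr (5 + 2 / real \<alpha>)"
      using a k by (intro mult_mono powr_mono) (simp_all add: power2_eq_square expand)
    finally show ?thesis .
  qed
  moreover have "real (card (cnf_vars F))
      \<le> 2 * real \<alpha> * 2 powr (real k / real \<alpha>) * real k powr (2 * (1 + 1 / real \<alpha>))"
  proof -
    have "cnf_vars F = \<Union>E" by (auto simp: cnf_vars_def F_def)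
    then have "real (card (cnf_vars F)) \<le> real (k * 2 ^ r)" using vars
      by (intro of_nat_mono) simp
    also have "\<dots> \<le> real k * (2 * real \<alpha> * 2 powr (real k / real \<alpha>) * real k powr (1 + 2 / real \<alpha>))"
      using r_le by (simp add: mult_left_mono)
    also have "\<dots> = 2 * real \<alpha> * 2 powr (real k / real \<alpha>) * real k powr (2 * (1 + 1 / real \<alpha>))"
      using powr_add[of "real k" 1 "1 + 2 / real \<alpha>"] k by (simp add: mult_ac)
    finally show ?thesis .
  qed
  moreover have "real (card F)
      \<le> real \<alpha> * 2 powr ((real k + real \<alpha>) * (1 + 1 / real \<alpha>)) * real k powr (2 * (1 + 1 / real \<alpha>))"
  proof -
    have "real (card F) = 2 ^ k * real k * 2 ^ r" by (simp add: cardF)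
    also have "\<dots> \<le> 2 ^ k * real k *
        (2 * real \<alpha> * 2 powr (real k / real \<alpha>) * real k powr (1 + 2 / real \<alpha>))"
      using r_le by (intro mult_left_mono) simp_all
    also have "\<dots> = real \<alpha> * 2 powr (real k + 1 + real k / real \<alpha>) * real k powr (2 * (1 + 1 / real \<alpha>))"
      using powr_realpow[of 2 k] powr_add[of "real k" 1 "1 + 2 / real \<alpha>"] k
      by (simp add: powr_add[of 2] mult_ac)
    \<comment> \<open>By \<open>expand\<close> with \<open>c = 1\<close> the exponent of 2 grows by
      \<open>\<alpha>\<close>.\<close>
    also have "\<dots> \<le> real \<alpha> * 2 powr ((real k + real \<alpha>) * (1 + 1 / real \<alpha>)) * real k powr (2 * (1 + 1 / real \<alpha>))"
      using a k by (intro mult_mono powr_mono) (simp_all add: expand)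
    finally show ?thesis .
  qed
  moreover have "real (max_clause_degree F) \<le> real \<alpha> * 2 ^ (k + \<alpha>) * (real k)\<^sup>2"
  proof -
    have "max_clause_degree F \<le> k * (2 ^ k * k)"
      unfolding max_clause_degree_def using finF \<open>F \<noteq> {}\<close> degF by (subst Max_le_iff) auto
    then have "real (max_clause_degree F) \<le> real (k * (2 ^ k * k))" by (rule of_nat_mono)
    also have "\<dots> = 1 * 2 ^ k * (real k)\<^sup>2" by (simp add: power2_eq_square)
    also have "\<dots> \<le> real \<alpha> * 2 ^ (k + \<alpha>) * (real k)\<^sup>2"
      using a k by (intro mult_mono power_increasing) simp_all
    finally show ?thesis .
  qed
  moreover have "\<not> satisfiable F" using f by (simp only: F_def not_False_eq_True)
  ultimately show ?thesis by (intro exI[of _ F] conjI)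
qed

end
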